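(* Let $q>0$ be a real number. For every $f(z)=\sum_{n=0}^\infty a_n z^{qn}$ with complex coefficients $a_n$ (the series converging for all $z\in\mathbb{C}\setminus\mathbb{R}_-$), it holds that for all $z\in\mathbb{C}\setminus\mathbb{R}_-$ $$[D^q_*,M_{z^q}](f)(z)=a_0\,\Gamma(q+1)+\sum_{n=1}^\infty a_n\,\beta_{n,q}\,z^{qn},$$ with the coefficients $$\beta_{n,q}=\frac{\Gamma(q(n+1)+1)}{\Gamma(qn+1)}-\frac{\Gamma(qn+1)}{\Gamma(q(n-1)+1)},\qquad n\ge 1.$$
   Context: Here $\mathbb{R}_-=(-\infty,0]$ and powers $z^{qn}$ are taken with the principal branch on $\mathbb{C}\setminus\mathbb{R}_-$. For $f(z)=\sum_{n=0}^\infty a_n z^{qn}$, the Caputo derivative of order $q$ is defined by $$D^q_*(f)(z)=\sum_{n=1}^\infty a_n\frac{\Gamma(qn+1)}{\Gamma(q(n-1)+1)}z^{q(n-1)}.$$ $M_{z^q}$ is the operator of multiplication by $z^q$, $M_{z^q}(f)(z)=z^q f(z)$, and the commutator is $$[D^q_*,M_{z^q}](f)(z)=D^q_*(z^q f)(z)-z^q D^q_*(f)(z).$$ *)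

theory Defs
  imports "HOL-Complex_Analysis.Complex_Analysis"
begin

text \<open>
  On \<open>- \<real>\<^sub>\<le>\<^sub>0\<close>, the complex plane slit along the closed negative real axis, the library's
  \<open>powr\<close> is the principal branch. Functions below are total, but only their values on this set
  matter.
\<close>

definition has_q_series :: "real \<Rightarrow> (nat \<Rightarrow> complex) \<Rightarrow> (complex \<Rightarrow> complex) \<Rightarrow> bool" where
  "has_q_series q a f \<longleftrightarrow>
     (\<forall>z \<in> - \<real>\<^sub>\<le>\<^sub>0. (\<lambda>n. a n * z powr of_real (q * real n)) sums f z)"

lemma has_q_series_unique:
  assumes "q > 0" "has_q_series q a f" "has_q_series q b f"
  shows "a = b"
proof -
  define c where "c = (\<lambda>n. a n - b n)"
  have zero: "(\<lambda>n. c n * of_real x ^ n) sums 0" if "x > 0" for x :: real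
  proof -
    define y where "y = x powr (1 / q)"
    have "y > 0" using that by (simp add: y_def)
    then have y: "complex_of_real y \<in> - \<real>\<^sub>\<le>\<^sub>0"
      by (auto simp: complex_nonpos_Reals_iff)
    have pw: "complex_of_real y powr of_real (q * real n) = of_real x ^ n" for n
    proof -
      have "y powr (q * real n) = x ^ n"
        using \<open>q > 0\<close> that by (simp add: y_def powr_powr powr_realpow)
      then show ?thesis
        using \<open>y > 0\<close> by (metis of_real_power powr_of_real less_imp_le)
    qed
    have "(\<lambda>n. a n * of_real x ^ n) sums f y"
      using bspec[OF assms(2)[unfolded has_q_series_def] y] by (simp only: pw)
    moreover have "(\<lambda>n. b n * of_real x ^ n) sums f y"
      using bspec[OF assms(3)[unfolded has_q_series_def] y] by (simp only: pw)
    ultimately have "(\<lambda>n. a n * of_real x ^ n - b n * of_real x ^ n) sums (f y - f y)"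
      by (rule sums_diff)
    then show ?thesis by (simp add: c_def algebra_simps)
  qed
  have "c n = 0" for n
  proof (induction n rule: less_induct)
    case (less n)
    have sh: "(\<lambda>k. c (k + n) * of_real x ^ k) sums 0" if "x > 0" for x :: real
    proof -
      have "(\<lambda>k. c (k + n) * of_real x ^ (k + n)) sums (0 - (\<Sum>k<n. c k * of_real x ^ k))"
        by (rule sums_split_initial_segment[OF zero[OF that]])
      then have "(\<lambda>k. c (k + n) * of_real x ^ (k + n)) sums 0"
        using less by simp
      then have "(\<lambda>k. c (k + n) * of_real x ^ (k + n) / of_real x ^ n) sums (0 / of_real x ^ n)"
        by (rule sums_divide)
      then show ?thesis using that by (simp add: power_add)
    qed
    define v where "v = (\<lambda>z::complex. \<Sum>k. c (k + n) * z ^ k)"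
    have sv: "(\<lambda>k. c (k + n) * z ^ k) sums v z" for z
    proof -
      have "summable (\<lambda>k. c (k + n) * of_real (norm z + 1) ^ k)"
        by (rule sums_summable, rule sh) (simp add: add_nonneg_pos)
      then have "summable (\<lambda>k. c (k + n) * z ^ k)"
        by (rule powser_inside) (simp only: norm_of_real)
      then show ?thesis by (simp add: v_def summable_sums)
    qed
    have "(v \<longlongrightarrow> c n) (at 0)"
      using powser_limit_0[of 1 "\<lambda>k. c (k + n)" v] sv by simp
    moreover have "filterlim complex_of_real (at 0) (at_right 0)"
      by (auto simp: filterlim_at eventually_at_filter intro!: tendsto_eq_intros)
    ultimately have "((\<lambda>x. v (of_real x)) \<longlongrightarrow> c n) (at_right (0::real))"
      by (rule filterlim_compose)
    moreover have "v (of_real x) = 0" if "x > 0" for x :: real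
      using sums_unique2[OF sv sh[OF that]] .
    then have "\<forall>\<^sub>F x in at_right (0::real). v (of_real x) = 0"
      by (auto simp: eventually_at_filter)
    ultimately have "((\<lambda>_. 0) \<longlongrightarrow> c n) (at_right (0::real))"
      using tendsto_cong by fastforce
    then show ?case
      by (simp add: tendsto_const_iff)
  qed
  then show ?thesis by (auto simp: c_def fun_eq_iff)
qed

definition q_coeff :: "real \<Rightarrow> (complex \<Rightarrow> complex) \<Rightarrow> nat \<Rightarrow> complex" where
  "q_coeff q f = (THE a. has_q_series q a f)"

text \<open>Sums over \<open>n \<ge> 1\<close> are encoded by summing over all naturals the term of index \<open>Suc n\<close>.\<close>

definition caputo_term :: "real \<Rightarrow> (nat \<Rightarrow> complex) \<Rightarrow> complex \<Rightarrow> nat \<Rightarrow> complex" where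
  "caputo_term q a z n =
     a n * of_real (Gamma (q * real n + 1) / Gamma (q * (real n - 1) + 1))
         * z powr of_real (q * (real n - 1))"

definition caputo :: "real \<Rightarrow> (complex \<Rightarrow> complex) \<Rightarrow> complex \<Rightarrow> complex" where
  "caputo q f z = (\<Sum>n. caputo_term q (q_coeff q f) z (Suc n))"

text \<open>Guards against the default values of \<open>THE\<close> and of \<open>suminf\<close> in \<^const>\<open>caputo\<close>.\<close>

definition caputo_exists :: "real \<Rightarrow> (complex \<Rightarrow> complex) \<Rightarrow> bool" where
  "caputo_exists q f \<longleftrightarrow>
     (\<exists>a. has_q_series q a f \<and> (\<forall>z \<in> - \<real>\<^sub>\<le>\<^sub>0. summable (\<lambda>n. caputo_term q a z (Suc n))))"

definition mult_zq :: "real \<Rightarrow> (complex \<Rightarrow> complex) \<Rightarrow> complex \<Rightarrow> complex" where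
  "mult_zq q f z = z powr of_real q * f z"

definition commutator ::
  "((complex \<Rightarrow> complex) \<Rightarrow> (complex \<Rightarrow> complex)) \<Rightarrow> ((complex \<Rightarrow> complex) \<Rightarrow> (complex \<Rightarrow> complex))
     \<Rightarrow> (complex \<Rightarrow> complex) \<Rightarrow> complex \<Rightarrow> complex" where
  "commutator S T f z = S (T f) z - T (S f) z"

definition beta_coeff :: "nat \<Rightarrow> real \<Rightarrow> real" where
  "beta_coeff n q =
     Gamma (q * (real n + 1) + 1) / Gamma (q * real n + 1)
       - Gamma (q * real n + 1) / Gamma (q * (real n - 1) + 1)"

end

theory Submission
  imports Defs "HOL-Real_Asymp.Real_Asymp"
begin

text \<open>
  On the slit plane the series in question are power series in \<open>w = z\<^sup>q\<close>, and \<open>w\<close> takes every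
  positive value, so \<open>\<Sum>a\<^sub>n w\<^sup>n\<close> has infinite radius of convergence. Log-convexity of \<open>\<Gamma>\<close> bounds the
  quotients \<open>\<Gamma>(q(n+1)+1) / \<Gamma>(qn+1)\<close> polynomially in \<open>n\<close>, so weighting the coefficients
  by them keeps the series convergent everywhere. The commutator is then computed by
  subtracting convergent series term by term.
\<close>

text \<open>For \<open>m > 0\<close>, \<open>x + q\<close> is the convex combination of
  \<open>x\<close> and \<open>x + m\<close> with weight \<open>t = q / m\<close>. Log-convexity thus
  gives \<open>Gamma (x + q) \<le> pochhammer x m powr t * Gamma x\<close>. As
  \<open>x \<ge> 1\<close>, the Pochhammer symbol is at least 1, so \<open>t\<close> may be raised
  to 1; each of its \<open>m\<close> factors is at most \<open>x + m\<close>.\<close>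

lemma Gamma_shift_le:
  fixes x q :: real
  assumes "x \<ge> 1" "q \<ge> 0" "q \<le> real m"
  shows "Gamma (x + q) \<le> (x + real m) ^ m * Gamma x"
proof (cases "m = 0")
  case True
  then show ?thesis using assms by simp
next
  case False
  define t where "t = q / real m"
  have t: "0 \<le> t" "t \<le> 1" using assms False by (auto simp: t_def)
  have Gpos: "Gamma y > 0" if "y \<ge> 1" for y :: real
    using that by (intro Gamma_real_pos) simp
  have Gx: "Gamma x > 0" "Gamma x \<noteq> 0"
    using Gpos[OF assms(1)] by (simp_all only: less_imp_neq[THEN not_sym] not_False_eq_True)
  have poch: "Gamma (x + real m) = pochhammer x m * Gamma x"
    using pochhammer_Gamma[of x m] Gx assms
    by (simp add: nonpos_Ints_def field_simps)
  have poch_ge: "pochhammer x m \<ge> 1"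
    unfolding pochhammer_prod using assms by (intro prod_ge_1) auto
  have "pochhammer x m \<le> (\<Prod>i<m. x + real m)"
    unfolding pochhammer_prod lessThan_atLeast0 using assms by (intro prod_mono) auto
  then have poch_le: "pochhammer x m \<le> (x + real m) ^ m" by simp
  have "(ln \<circ> Gamma) ((1 - t) *\<^sub>R x + t *\<^sub>R (x + real m)) \<le>
      (1 - t) * (ln \<circ> Gamma) x + t * (ln \<circ> Gamma) (x + real m)"
    using assms t by (intro convex_onD[OF log_convex_Gamma_real]) auto
  moreover have "(1 - t) *\<^sub>R x + t *\<^sub>R (x + real m) = x + q"
    using False by (simp add: t_def field_simps)
  ultimately have "ln (Gamma (x + q)) \<le> (1 - t) * ln (Gamma x) + t * ln (Gamma (x + real m))"
    by (simp only: o_apply)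
  also have "ln (Gamma (x + real m)) = ln (pochhammer x m) + ln (Gamma x)"
    using poch_ge Gx by (simp add: poch ln_mult)
  also have "(1 - t) * ln (Gamma x) + t * (ln (pochhammer x m) + ln (Gamma x)) =
      t * ln (pochhammer x m) + ln (Gamma x)"
    by (simp add: algebra_simps)
  also have "\<dots> \<le> ln (pochhammer x m) + ln (Gamma x)"
    using t poch_ge by (intro add_right_mono mult_left_le_one_le) auto
  also have "ln (pochhammer x m) + ln (Gamma x) = ln (pochhammer x m * Gamma x)"
    using poch_ge Gx by (simp add: ln_mult)
  finally have "Gamma (x + q) \<le> pochhammer x m * Gamma x"
    using Gx Gpos[of "x + q"] assms poch_ge by (subst (asm) ln_le_cancel_iff) auto
  also have "\<dots> \<le> (x + real m) ^ m * Gamma x"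
    using poch_le Gx by (intro mult_right_mono) auto
  finally show ?thesis .
qed

text \<open>The weight that the Caputo derivative puts on the coefficient of index
  \<open>Suc n\<close>. Consecutive differences of these weights are the
  \<open>beta_coeff\<close>.\<close>

definition gamma_quot :: "real \<Rightarrow> nat \<Rightarrow> real" where
  "gamma_quot q n = Gamma (q * (real n + 1) + 1) / Gamma (q * real n + 1)"

lemma gamma_quot_bound:
  assumes "q > 0"
  obtains C where "\<And>n. \<bar>gamma_quot q n\<bar> \<le> C * 2 ^ n"
proof -
  define m where "m = nat \<lceil>q\<rceil>"
  have "q \<le> real m" by (simp add: m_def real_nat_ceiling_ge)
  define g where "g n = (q * real n + 1 + real m) ^ m" for n
  have quot_le: "\<bar>gamma_quot q n\<bar> \<le> g n" for n
  proof -
    have "Gamma (q * (real n + 1) + 1) \<le> g n * Gamma (q * real n + 1)"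
      using Gamma_shift_le[of "q * real n + 1" q m] assms \<open>q \<le> real m\<close>
      by (simp add: g_def algebra_simps)
    moreover have "Gamma (q * (real n + 1) + 1) > 0" "Gamma (q * real n + 1) > 0"
      using assms by (auto intro!: Gamma_real_pos add_nonneg_pos)
    ultimately show ?thesis
      by (simp add: gamma_quot_def divide_le_eq abs_of_pos)
  qed
  \<comment> \<open>A polynomial over an exponential tends to 0 and is therefore bounded, so one
    \<open>C\<close> serves all \<open>n\<close>. The base 2 is arbitrary; any base above 1 would
    do.\<close>
  have "(\<lambda>n. g n / 2 ^ n) \<longlonglongrightarrow> 0"
    unfolding g_def using assms by real_asymp
  then have "Bseq (\<lambda>n. g n / 2 ^ n)"
    by (intro convergent_imp_Bseq convergentI)
  then obtain C where "\<And>n. norm (g n / 2 ^ n) \<le> C" by (auto simp: Bseq_def)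
  then have "g n \<le> C * 2 ^ n" for n
    using abs_le_D1[of "g n / 2 ^ n" C] by (simp add: divide_le_eq)
  with quot_le that show ?thesis by (meson order_trans)
qed

lemma powr_mult_of_nat:
  fixes z :: complex
  assumes "z \<noteq> 0"
  shows "z powr of_real (q * real n) = (z powr of_real q) ^ n"
  using assms by (simp add: powr_def exp_of_nat_mult[symmetric] mult_ac)

text \<open>Here \<open>w\<close> is any complex number, not only a value of
  \<open>z powr q\<close>: for small \<open>q\<close> those values fill just a sector. Convergence
  at one positive real beyond \<open>norm w\<close> suffices, and every positive real is the
  \<open>q\<close>-th power of a positive real.\<close>

lemma has_q_series_summable_norm:
  assumes "q > 0" "has_q_series q a f"
  shows "summable (\<lambda>n. norm (a n * w ^ n))"
proof -
  \<comment> \<open>Adding 1 makes \<open>x\<close> positive and strictly larger than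
    \<open>norm w\<close>, as absolute convergence at \<open>w\<close> demands.\<close>
  define x where "x = norm w + 1"
  have "x > 0" by (simp add: x_def add_nonneg_pos)
  define y where "y = x powr (1 / q)"
  have "y > 0" using \<open>x > 0\<close> by (simp add: y_def)
  then have "complex_of_real y \<in> - \<real>\<^sub>\<le>\<^sub>0"
    by (auto simp: complex_nonpos_Reals_iff)
  then have "summable (\<lambda>n. a n * complex_of_real y powr of_real (q * real n))"
    using assms(2) sums_summable unfolding has_q_series_def by blast
  moreover have "complex_of_real y powr of_real q = of_real x"
    using \<open>q > 0\<close> \<open>x > 0\<close> \<open>y > 0\<close> by (simp add: powr_of_real y_def powr_powr)
  ultimately have "summable (\<lambda>n. a n * of_real x ^ n)"
    using \<open>y > 0\<close> by (simp add: powr_mult_of_nat del: of_real_mult)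
  then show ?thesis
    by (rule powser_insidea) (simp add: x_def)
qed

text \<open>The geometric growth of the weights is absorbed into the argument: the series is
  compared with the absolutely convergent one at \<open>2 * w\<close>.\<close>

lemma has_q_series_summable_weighted:
  assumes "q > 0" "has_q_series q a f"
    and "\<And>n. \<bar>r n\<bar> \<le> C * 2 ^ n"
  shows "summable (\<lambda>n. a n * of_real (r n) * w ^ n)"
proof (rule summable_comparison_test')
  show "summable (\<lambda>n. C * norm (a n * (2 * w) ^ n))"
    using has_q_series_summable_norm[OF assms(1,2)] by (intro summable_mult)
  fix n :: nat
  have "norm (a n * of_real (r n) * w ^ n) = \<bar>r n\<bar> * (norm (a n) * norm w ^ n)"
    by (simp add: norm_mult norm_power)
  also have "\<dots> \<le> C * 2 ^ n * (norm (a n) * norm w ^ n)"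
    using assms(3) by (intro mult_right_mono) auto
  finally show "norm (a n * of_real (r n) * w ^ n) \<le> C * norm (a n * (2 * w) ^ n)"
    by (simp add: norm_mult norm_power power_mult_distrib mult_ac)
qed

lemma q_coeff_eq:
  assumes "q > 0" "has_q_series q a f"
  shows "q_coeff q f = a"
  unfolding q_coeff_def using assms has_q_series_unique by blast

lemma caputo_term_Suc:
  assumes "z \<noteq> 0"
  shows "caputo_term q a z (Suc n) =
    a (Suc n) * of_real (gamma_quot q n) * (z powr of_real q) ^ n"
  using powr_mult_of_nat[OF assms, of q n]
  by (simp add: caputo_term_def gamma_quot_def add_ac del: of_real_mult)

text \<open>In the variable \<open>z powr q\<close>, multiplication by \<open>z powr q\<close>
  shifts the coefficients by one place and puts 0 in front.\<close>

lemma has_q_series_mult_zq: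
  assumes "has_q_series q a f"
  shows "has_q_series q (case_nat 0 a) (mult_zq q f)"
  unfolding has_q_series_def
proof
  fix z :: complex
  assume z: "z \<in> - \<real>\<^sub>\<le>\<^sub>0"
  then have "z \<noteq> 0" by auto
  let ?w = "z powr of_real q"
  have "(\<lambda>n. ?w * (a n * ?w ^ n)) sums mult_zq q f z"
    using bspec[OF assms[unfolded has_q_series_def] z]
    unfolding mult_zq_def powr_mult_of_nat[OF \<open>z \<noteq> 0\<close>] by (rule sums_mult)
  then have "(\<lambda>n. case_nat 0 a (Suc n) * ?w ^ Suc n) sums mult_zq q f z"
    by (simp add: mult_ac)
  then show "(\<lambda>n. case_nat 0 a n * z powr of_real (q * real n)) sums mult_zq q f z"
    unfolding powr_mult_of_nat[OF \<open>z \<noteq> 0\<close>] by (subst (asm) sums_Suc_iff) simp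
qed

theorem proposition5p2:
  fixes q :: real and a :: "nat \<Rightarrow> complex" and f :: "complex \<Rightarrow> complex"
  assumes "q > 0"
    and "has_q_series q a f"
  shows "caputo_exists q f \<and> caputo_exists q (mult_zq q f) \<and>
    (\<forall>z \<in> - \<real>\<^sub>\<le>\<^sub>0.
       summable (\<lambda>n. a (Suc n) * of_real (beta_coeff (Suc n) q) * z powr of_real (q * real (Suc n))) \<and>
       commutator (caputo q) (mult_zq q) f z =
         a 0 * of_real (Gamma (q + 1)) +
         (\<Sum>n. a (Suc n) * of_real (beta_coeff (Suc n) q) * z powr of_real (q * real (Suc n))))"
proof -
  let ?b = "case_nat 0 a"
  note b = has_q_series_mult_zq[OF assms(2)]
  obtain C where C: "\<And>n. \<bar>gamma_quot q n\<bar> \<le> C * 2 ^ n"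
    using gamma_quot_bound[OF assms(1)] by blast
  have "C \<ge> 0" using C[of 0] by simp
  \<comment> \<open>Weights aligned with \<open>a n\<close> instead of \<open>a (Suc n)\<close>. At
    \<open>n = 0\<close> the truncated subtraction yields \<open>gamma_quot q 0\<close>, harmless
    because that term is split off below.\<close>
  have C': "\<bar>gamma_quot q (n - 1)\<bar> \<le> C * 2 ^ n" for n
  proof -
    have "C * 2 ^ (n - 1) \<le> C * 2 ^ n"
      using \<open>C \<ge> 0\<close> by (intro mult_left_mono power_increasing) auto
    with C[of "n - 1"] show ?thesis by linarith
  qed
  have sum_b: "summable (\<lambda>n. a n * of_real (gamma_quot q n) * w ^ n)" for w
    using has_q_series_summable_weighted[OF assms C] .
  have sum_a_Suc: "summable (\<lambda>n. a (Suc n) * of_real (gamma_quot q n) * w ^ Suc n)" for w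
    using has_q_series_summable_weighted[OF assms C', of w]
    by (subst (asm) summable_Suc_iff[symmetric]) simp
  have sum_a: "summable (\<lambda>n. a (Suc n) * of_real (gamma_quot q n) * w ^ n)" if "w \<noteq> 0" for w
    using summable_divide[OF sum_a_Suc, of w w] that by (simp add: mult.assoc)

  have "caputo_exists q f"
    unfolding caputo_exists_def
  proof (intro exI conjI ballI)
    fix z :: complex assume "z \<in> - \<real>\<^sub>\<le>\<^sub>0"
    then have "z \<noteq> 0" by auto
    then show "summable (\<lambda>n. caputo_term q a z (Suc n))"
      using sum_a[of "z powr of_real q"] by (simp add: caputo_term_Suc)
  qed (rule assms)
  moreover have "caputo_exists q (mult_zq q f)"
    unfolding caputo_exists_def
  proof (intro exI conjI ballI)
    fix z :: complex assume "z \<in> - \<real>\<^sub>\<le>\<^sub>0"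
    then have "z \<noteq> 0" by auto
    then show "summable (\<lambda>n. caputo_term q ?b z (Suc n))"
      using sum_b by (simp add: caputo_term_Suc)
  qed (rule b)
  \<comment> \<open>Stated with \<open>sums\<close>, this yields both the convergence and the value
    of the series; the constant term stands on the right.\<close>
  moreover have
    "(\<lambda>n. a (Suc n) * of_real (beta_coeff (Suc n) q) * z powr of_real (q * real (Suc n))) sums
      (commutator (caputo q) (mult_zq q) f z - a 0 * of_real (Gamma (q + 1)))"
    if "z \<in> - \<real>\<^sub>\<le>\<^sub>0" for z
  proof -
    define w where "w = z powr of_real q"
    from that have "z \<noteq> 0" by auto
    then have "w \<noteq> 0" by (simp add: w_def)
    have "(\<lambda>n. a n * of_real (gamma_quot q n) * w ^ n) sums caputo q (mult_zq q f) z"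
      using summable_sums[OF sum_b[of w]] \<open>z \<noteq> 0\<close>
      by (simp add: caputo_def q_coeff_eq[OF assms(1) b] caputo_term_Suc w_def)
    \<comment> \<open>The split-off term of index 0 is \<open>a 0 * Gamma (q + 1)\<close>, because
      \<open>Gamma 1 = 1\<close>.\<close>
    then have b_sums: "(\<lambda>n. a (Suc n) * of_real (gamma_quot q (Suc n)) * w ^ Suc n) sums
        (caputo q (mult_zq q f) z - a 0 * of_real (Gamma (q + 1)))"
      by (subst sums_Suc_iff) (simp add: gamma_quot_def)
    have "(\<lambda>n. a (Suc n) * of_real (gamma_quot q n) * w ^ n) sums caputo q f z"
      using summable_sums[OF sum_a[OF \<open>w \<noteq> 0\<close>]] \<open>z \<noteq> 0\<close>
      by (simp add: caputo_def q_coeff_eq[OF assms] caputo_term_Suc w_def)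
    \<comment> \<open>The extra factor \<open>w\<close> raises the power to
      \<open>w ^ Suc n\<close>, so that this series can be subtracted from \<open>b_sums\<close>
      term by term.\<close>
    then have a_sums: "(\<lambda>n. w * (a (Suc n) * of_real (gamma_quot q n) * w ^ n)) sums
        mult_zq q (caputo q f) z"
      unfolding mult_zq_def w_def by (rule sums_mult)
    have beta: "beta_coeff (Suc n) q = gamma_quot q (Suc n) - gamma_quot q n" for n
      by (simp add: beta_coeff_def gamma_quot_def add_ac)
    have "(\<lambda>n. a (Suc n) * of_real (gamma_quot q (Suc n)) * w ^ Suc n -
          w * (a (Suc n) * of_real (gamma_quot q n) * w ^ n)) sums
        (caputo q (mult_zq q f) z - a 0 * of_real (Gamma (q + 1)) - mult_zq q (caputo q f) z)"
      using b_sums a_sums by (rule sums_diff)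
    then show ?thesis
      unfolding powr_mult_of_nat[OF \<open>z \<noteq> 0\<close>] w_def[symmetric] beta commutator_def
      by (simp add: algebra_simps)
  qed
  then have "\<forall>z \<in> - \<real>\<^sub>\<le>\<^sub>0.
       summable (\<lambda>n. a (Suc n) * of_real (beta_coeff (Suc n) q) * z powr of_real (q * real (Suc n))) \<and>
       commutator (caputo q) (mult_zq q) f z =
         a 0 * of_real (Gamma (q + 1)) +
         (\<Sum>n. a (Suc n) * of_real (beta_coeff (Suc n) q) * z powr of_real (q * real (Suc n)))"
    by (auto simp: sums_iff simp del: of_nat_Suc)
  ultimately show ?thesis by blast
qed

end
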